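(* Consider the multi-criteria problem with feasible set $S$ and real-valued criteria $F_1,\dots,F_n$ (each to be maximized or minimized), and let $W_i$ be the worst value of $F_i$ on $S$. If $\vec X_{opt}\in S$ is an optimal solution of the single-criterion problem $$\theta(\vec X)=\sqrt{\sum_{i=1}^n\,[W_i-F_i(\vec X)]^2}\;\to\;\max\quad\text{over }\vec X\in S,$$ then $\vec X_{opt}$ is a Pareto-optimal solution of the multi-criteria problem.
   Context: Multi-criteria problem: vectors of variables are $\vec X=(x_1,\dots,x_m)$ with $x_k\in X_k$ for given sets $X_k$, subject to restrictions $\varphi_j(\vec X)\le b_j$ for all $j$, where the $\varphi_j$ are real-valued functions and the $b_j$ are real numbers. The feasible set $S$ is the set of all such $\vec X$ satisfying all restrictions. There are $n\ge 1$ real-valued criteria $F_i(\vec X)$, $i\in I=\{1,\dots,n\}$, and for each $i$ it is specified whether $F_i$ is to be maximized or minimized. Best and worst values: if $F_i$ is to be maximized, then $K_i=\max_{S}F_i$ and $W_i=\min_{S}F_i$; if $F_i$ is to be minimized, then $K_i=\min_{S}F_i$ and $W_i=\max_{S}F_i$. Standing assumptions: these extrema exist, and $K_i\ne W_i$ for every $i$. The points $(K_1,\dots,K_n)$ and $(W_1,\dots,W_n)$ of criteria space need not be attained by a feasible vector. Pareto-optimality: $\vec X\in S$ is Pareto-optimal if there is no $\vec X'\in S$ such that, for every $i$, $F_i(\vec X')$ is at least as good as $F_i(\vec X)$ (that is, $\ge$ if $F_i$ is maximized, $\le$ if $F_i$ is minimized), with strict improvement for at least one $i$. *)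

theory Defs
  imports "HOL-Analysis.Analysis"
begin

(* A vector (x_1, ..., x_m) is an extensional function on {1..m} (undefined elsewhere), so
   different functions are different vectors.  The sets X k may be unrelated subsets of 'a. *)
definition feasible_set ::
  "nat \<Rightarrow> (nat \<Rightarrow> 'a set) \<Rightarrow> 'j set \<Rightarrow> ('j \<Rightarrow> (nat \<Rightarrow> 'a) \<Rightarrow> real) \<Rightarrow> ('j \<Rightarrow> real) \<Rightarrow> (nat \<Rightarrow> 'a) set"
  where "feasible_set m X J \<phi> b = {x \<in> Pi\<^sub>E {1..m} X. \<forall>j\<in>J. \<phi> j x \<le> b j}"

datatype sense = Maximize | Minimize

definition is_max_value :: "('v \<Rightarrow> real) \<Rightarrow> 'v set \<Rightarrow> real \<Rightarrow> bool"
  where "is_max_value f S v \<longleftrightarrow> (\<exists>x. is_arg_max f (\<lambda>x. x \<in> S) x \<and> v = f x)"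

definition is_min_value :: "('v \<Rightarrow> real) \<Rightarrow> 'v set \<Rightarrow> real \<Rightarrow> bool"
  where "is_min_value f S v \<longleftrightarrow> (\<exists>x. is_arg_min f (\<lambda>x. x \<in> S) x \<and> v = f x)"

(* The next two are relations rather than functions, so that asserting them includes the
   existence of the extremum; the value is then unique. *)
fun is_best_value :: "sense \<Rightarrow> ('v \<Rightarrow> real) \<Rightarrow> 'v set \<Rightarrow> real \<Rightarrow> bool"
  where
    "is_best_value Maximize f S v = is_max_value f S v"
  | "is_best_value Minimize f S v = is_min_value f S v"

fun is_worst_value :: "sense \<Rightarrow> ('v \<Rightarrow> real) \<Rightarrow> 'v set \<Rightarrow> real \<Rightarrow> bool"
  where
    "is_worst_value Maximize f S v = is_min_value f S v"
  | "is_worst_value Minimize f S v = is_max_value f S v"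

fun at_least_as_good :: "sense \<Rightarrow> real \<Rightarrow> real \<Rightarrow> bool"
  where
    "at_least_as_good Maximize a b \<longleftrightarrow> a \<ge> b"
  | "at_least_as_good Minimize a b \<longleftrightarrow> a \<le> b"

fun strictly_better :: "sense \<Rightarrow> real \<Rightarrow> real \<Rightarrow> bool"
  where
    "strictly_better Maximize a b \<longleftrightarrow> a > b"
  | "strictly_better Minimize a b \<longleftrightarrow> a < b"

definition pareto_optimal ::
  "nat \<Rightarrow> (nat \<Rightarrow> sense) \<Rightarrow> (nat \<Rightarrow> 'v \<Rightarrow> real) \<Rightarrow> 'v set \<Rightarrow> 'v \<Rightarrow> bool"
  where "pareto_optimal n dir F S x \<longleftrightarrow>
    x \<in> S \<and>
    \<not> (\<exists>x'\<in>S. (\<forall>i\<in>{1..n}. at_least_as_good (dir i) (F i x') (F i x)) \<and>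
               (\<exists>i\<in>{1..n}. strictly_better (dir i) (F i x') (F i x)))"

definition \<theta> :: "nat \<Rightarrow> (nat \<Rightarrow> real) \<Rightarrow> (nat \<Rightarrow> 'v \<Rightarrow> real) \<Rightarrow> 'v \<Rightarrow> real"
  where "\<theta> n W F x = sqrt (\<Sum>i=1..n. (W i - F i x)\<^sup>2)"

end

theory Submission
  imports Defs
begin

text \<open>
  Every feasible value of a criterion lies on the good side of its worst value, so on \<open>S\<close> the
  distance \<open>\<bar>W i - F i x\<bar>\<close> measures how good \<open>F i x\<close> is, whether the criterion is maximized
  or minimized: improving a criterion moves it away from its worst value
  (\<open>sq_dist_mono\<close>, \<open>sq_dist_strict_mono\<close>). Hence \<open>\<theta>\<close>, the Euclidean distance from the
  worst point, strictly increases when a feasible vector is replaced by one that dominates it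
  (\<open>\<theta>_less_of_dominates\<close>), and a dominated vector cannot maximize \<open>\<theta>\<close>.
\<close>

lemma at_least_as_good_worst_value:
  assumes "is_worst_value s f S w" and "x \<in> S"
  shows "at_least_as_good s (f x) w"
  using assms
  by (cases s)
    (auto simp: is_max_value_def is_min_value_def is_arg_max_def is_arg_min_def not_less)

text \<open>
  The hypothesis that \<open>a\<close> is no worse than \<open>w\<close> makes \<open>w\<close>, \<open>a\<close>, \<open>a'\<close> monotonically ordered;
  an improvement starting on the other side of \<open>w\<close> could reduce the distance.
\<close>

lemma sq_dist_mono:
  assumes "at_least_as_good s a w" and "at_least_as_good s a' a"
  shows "(w - a)\<^sup>2 \<le> (w - a')\<^sup>2"
  using assms by (cases s) (auto simp: abs_le_square_iff [symmetric])

lemma sq_dist_strict_mono: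
  assumes "at_least_as_good s a w" and "strictly_better s a' a"
  shows "(w - a)\<^sup>2 < (w - a')\<^sup>2"
proof -
  have "\<bar>w - a\<bar> < \<bar>w - a'\<bar>"
    using assms by (cases s) auto
  then have "\<bar>w - a\<bar>\<^sup>2 < \<bar>w - a'\<bar>\<^sup>2"
    by (rule power_strict_mono) simp_all
  then show ?thesis
    by simp
qed

lemma \<theta>_less_of_dominates:
  assumes "\<forall>i\<in>{1..n}. at_least_as_good (dir i) (F i x) (W i)"
    and "\<forall>i\<in>{1..n}. at_least_as_good (dir i) (F i x') (F i x)"
    and "\<exists>i\<in>{1..n}. strictly_better (dir i) (F i x') (F i x)"
  shows "\<theta> n W F x < \<theta> n W F x'"
proof -
  have "(\<Sum>i=1..n. (W i - F i x)\<^sup>2) < (\<Sum>i=1..n. (W i - F i x')\<^sup>2)"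
  proof (rule sum_strict_mono_ex1)
    show "\<forall>i\<in>{1..n}. (W i - F i x)\<^sup>2 \<le> (W i - F i x')\<^sup>2"
      using assms(1,2) by (blast intro: sq_dist_mono)
    show "\<exists>i\<in>{1..n}. (W i - F i x)\<^sup>2 < (W i - F i x')\<^sup>2"
      using assms(1,3) by (blast intro: sq_dist_strict_mono)
  qed simp
  then show ?thesis
    by (simp add: \<theta>_def)
qed

theorem theorem2:
  fixes m n :: nat
    and X :: "nat \<Rightarrow> 'a set"
    and J :: "'j set"
    and \<phi> :: "'j \<Rightarrow> (nat \<Rightarrow> 'a) \<Rightarrow> real"
    and b :: "'j \<Rightarrow> real"
    and S :: "(nat \<Rightarrow> 'a) set"
    and F :: "nat \<Rightarrow> (nat \<Rightarrow> 'a) \<Rightarrow> real"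
    and dir :: "nat \<Rightarrow> sense"
    and K W :: "nat \<Rightarrow> real"
    and x_opt :: "nat \<Rightarrow> 'a"
  assumes "n \<ge> 1"
    and "S = feasible_set m X J \<phi> b"
    and "\<And>i. i \<in> {1..n} \<Longrightarrow> is_best_value (dir i) (F i) S (K i)"
    and "\<And>i. i \<in> {1..n} \<Longrightarrow> is_worst_value (dir i) (F i) S (W i)"
    and "\<And>i. i \<in> {1..n} \<Longrightarrow> K i \<noteq> W i"
    and "is_arg_max (\<theta> n W F) (\<lambda>x. x \<in> S) x_opt"
  shows "pareto_optimal n dir F S x_opt"
proof -
  have feasible: "x_opt \<in> S"
    using assms(6) by (simp add: is_arg_max_def)
  have maximal: "\<not> \<theta> n W F x_opt < \<theta> n W F x'" if "x' \<in> S" for x'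
    using assms(6) that by (simp add: is_arg_max_def)
  have no_worse: "\<forall>i\<in>{1..n}. at_least_as_good (dir i) (F i x_opt) (W i)"
    using at_least_as_good_worst_value [OF assms(4) feasible] by blast
  have increase: "\<theta> n W F x_opt < \<theta> n W F x'"
    if "\<forall>i\<in>{1..n}. at_least_as_good (dir i) (F i x') (F i x_opt)"
      and "\<exists>i\<in>{1..n}. strictly_better (dir i) (F i x') (F i x_opt)" for x'
    by (rule \<theta>_less_of_dominates
        [where F = F and W = W and x = x_opt and x' = x', OF no_worse that])
  show ?thesis
    unfolding pareto_optimal_def using feasible maximal increase by blast
qed

end
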